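(* Let $m$ be a positive integer, let $s=(-1)^m$, and let $S$ be the $s$-symmetrization operator. Let $f$ and $g$ be LPs of lengths $n$ and $\delta$ respectively, and define the LPs $$f_1=f\lor g,\qquad f_2=f\lor g\lor (s\,g^* )$$ of lengths $n+\delta$ and $n+2\delta$. If $S(f)\in\mathcal{P}(2n,m)$ and $S(f_1)\in\mathcal{P}(2n+2\delta,m)$, then $S(f_2)\in\mathcal{P}(2n+4\delta,m)$.
   Context: A Littlewood polynomial (LP) of length $n$ is a polynomial $f(x)=\sum_{i=0}^{n-1}a_ix^i$ with every $a_i\in\{1,-1\}$; its length is denoted $\ell(f)=n$. An LP has order $m$ if $(x-1)^m$ divides it; $\mathcal{P}(n,m)$ is the set of LPs of length $n$ and order $m$. The join of LPs $f,g$ is $(f\lor g)(x)=f(x)+x^{\ell(f)}g(x)$, an LP of length $\ell(f)+\ell(g)$ (the join is associative). The reversal of an LP $f$ is $f^*(x)=x^{\ell(f)-1}f(1/x)$. For $s\in\{1,-1\}$, the $s$-symmetrization of an LP $f$ is $S(f)=f\lor(s f^* )$. *)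

theory Defs
  imports "HOL-Computational_Algebra.Polynomial"
begin

definition littlewood :: "nat \<Rightarrow> int poly set" where
  "littlewood n = {f. \<exists>a. (\<forall>i<n. a i \<in> {1, -1}) \<and> f = (\<Sum>i<n. monom (a i) i)}"

text \<open>
  A Littlewood polynomial has a nonzero leading coefficient, so its length can be read off from
  the polynomial itself (lemma \<open>lp_length_littlewood\<close>). The only polynomial of length \<open>0\<close> is \<open>0\<close>.
\<close>

definition lp_length :: "int poly \<Rightarrow> nat" where
  "lp_length f = length (coeffs f)"

definition littlewood_order :: "nat \<Rightarrow> nat \<Rightarrow> int poly set" where
  "littlewood_order n m = {f \<in> littlewood n. [:-1, 1:] ^ m dvd f}"

definition lp_join :: "int poly \<Rightarrow> int poly \<Rightarrow> int poly"  (infixr "\<squnion>\<^sub>L" 65) where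
  "f \<squnion>\<^sub>L g = f + monom 1 (lp_length f) * g"

text \<open>
  The reversal $x^{\ell(f)-1} f(1/x)$ is the library's \<^const>\<open>reflect_poly\<close>: for nonzero \<open>f\<close> the degree
  is $\ell(f) - 1$ (see lemma \<open>coeff_reversal_littlewood\<close>).
\<close>

definition lp_symm :: "int \<Rightarrow> int poly \<Rightarrow> int poly" where
  "lp_symm s f = f \<squnion>\<^sub>L smult s (reflect_poly f)"

lemma coeff_littlewood_sum:
  "coeff (\<Sum>i<n. monom (a i) i) k = (if k < n then a k else (0::int))"
  by (simp add: coeff_sum if_distrib sum.delta cong: if_cong)

lemma littlewood_iff:
  "f \<in> littlewood n \<longleftrightarrow> (\<forall>i<n. coeff f i \<in> {1, -1}) \<and> (\<forall>i\<ge>n. coeff f i = 0)"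
proof
  assume "f \<in> littlewood n"
  then show "(\<forall>i<n. coeff f i \<in> {1, -1}) \<and> (\<forall>i\<ge>n. coeff f i = 0)"
    unfolding littlewood_def by (auto simp: coeff_littlewood_sum)
next
  assume *: "(\<forall>i<n. coeff f i \<in> {1, -1}) \<and> (\<forall>i\<ge>n. coeff f i = 0)"
  then have "f = (\<Sum>i<n. monom (coeff f i) i)"
    by (intro poly_eqI) (auto simp: coeff_littlewood_sum)
  with * show "f \<in> littlewood n"
    unfolding littlewood_def by blast
qed

lemma degree_littlewood:
  assumes "f \<in> littlewood n" "n > 0"
  shows "f \<noteq> 0" "degree f = n - 1"
proof -
  have "coeff f (n - 1) \<in> {1, -1}" and z: "\<forall>i>n - 1. coeff f i = 0"
    using assms by (auto simp: littlewood_iff)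
  then have "coeff f (n - 1) \<noteq> 0" by auto
  then show "f \<noteq> 0" by auto
  show "degree f = n - 1"
    using \<open>coeff f (n - 1) \<noteq> 0\<close> z by (intro antisym degree_le le_degree) auto
qed

lemma lp_length_littlewood:
  assumes "f \<in> littlewood n"
  shows "lp_length f = n"
proof (cases "n = 0")
  case True
  with assms have "f = 0" by (auto simp: littlewood_def)
  with True show ?thesis by (simp add: lp_length_def)
next
  case False
  with degree_littlewood[OF assms] show ?thesis
    by (simp add: lp_length_def length_coeffs_degree)
qed

lemma coeff_reversal_littlewood:
  assumes "f \<in> littlewood n" "i < n"
  shows "coeff (reflect_poly f) i = coeff f (n - 1 - i)"
  using assms degree_littlewood[of f n] by (simp add: coeff_reflect_poly)

lemma reversal_littlewood:
  assumes "f \<in> littlewood n" and "s \<in> {1, -1}"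
  shows "smult s (reflect_poly f) \<in> littlewood n"
proof (cases "n = 0")
  case True
  with assms show ?thesis by (auto simp: littlewood_def)
next
  case False
  have "coeff (reflect_poly f) i \<in> {1, -1}" if "i < n" for i
    using assms(1) that by (auto simp: coeff_reversal_littlewood littlewood_iff)
  moreover have "coeff (reflect_poly f) i = 0" if "i \<ge> n" for i
    using degree_littlewood[OF assms(1)] False that by (simp add: coeff_reflect_poly)
  ultimately show ?thesis
    using assms(2) unfolding littlewood_iff coeff_smult by fastforce
qed

lemma join_littlewood:
  assumes "f \<in> littlewood n" and "g \<in> littlewood k"
  shows "f \<squnion>\<^sub>L g \<in> littlewood (n + k)"
proof -
  have "coeff (f \<squnion>\<^sub>L g) i = (if i < n then coeff f i else coeff g (i - n))" for i
    using assms(1) by (auto simp: lp_join_def lp_length_littlewood[OF assms(1)]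
        coeff_monom_mult littlewood_iff)
  with assms show ?thesis by (auto simp: littlewood_iff)
qed

end

theory Submission
  imports Defs
begin

text \<open>
  The polynomial \<open>h = S(g)\<close> satisfies \<open>h\<^sup>* = s h\<close>, so that
  \<open>S(f\<^sub>1) = f + x\<^sup>n h + s x\<^bsup>n+2\<delta>\<^esup> f\<^sup>*\<close> and
  \<open>S(f\<^sub>2) = f + x\<^sup>n h + x\<^bsup>n+2\<delta>\<^esup> h + s x\<^bsup>n+4\<delta>\<^esup> f\<^sup>*\<close>. Hence
  \<open>S(f\<^sub>2) = (1 + x\<^bsup>2\<delta>\<^esup>) S(f\<^sub>1) - x\<^bsup>2\<delta>\<^esup> S(f)\<close>, and a common divisor of \<open>S(f)\<close> and
  \<open>S(f\<^sub>1)\<close> divides \<open>S(f\<^sub>2)\<close>.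
\<close>

lemma lp_join_eq:
  assumes "f \<in> littlewood n"
  shows "f \<squnion>\<^sub>L g = f + monom 1 n * g"
  by (simp add: lp_join_def lp_length_littlewood[OF assms])

lemma reflect_poly_littlewood:
  assumes "f \<in> littlewood n"
  shows "reflect_poly f \<in> littlewood n"
  using reversal_littlewood[OF assms, of 1] by simp

text \<open>Read backwards, the coefficients of \<open>g\<close> come before those of
  \<open>f\<close>. \<open>reflect_poly\<close> reverses with respect to the degree; membership in
  \<open>littlewood\<close> ties the degree to the length, so the blocks line up.\<close>

lemma reflect_poly_join:
  assumes f: "f \<in> littlewood n" and g: "g \<in> littlewood k"
  shows "reflect_poly (f \<squnion>\<^sub>L g) = reflect_poly g \<squnion>\<^sub>L reflect_poly f"
proof (rule poly_eqI)
  fix i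
  have fg: "f \<squnion>\<^sub>L g \<in> littlewood (n + k)"
    and gf: "reflect_poly g \<squnion>\<^sub>L reflect_poly f \<in> littlewood (k + n)"
    using f g by (auto intro: join_littlewood reflect_poly_littlewood)
  show "coeff (reflect_poly (f \<squnion>\<^sub>L g)) i = coeff (reflect_poly g \<squnion>\<^sub>L reflect_poly f) i"
  proof (cases "i < n + k")
    case True
    have f0: "coeff f j = 0" if "j \<ge> n" for j
      using f that by (simp add: littlewood_iff)
    have g0: "coeff (reflect_poly g) j = 0" if "j \<ge> k" for j
      using reflect_poly_littlewood[OF g] that by (simp add: littlewood_iff)
    show ?thesis
    proof (cases "i < k")
      case True
      \<comment> \<open>Here the mirrored index \<open>n + k - 1 - i\<close> is at least
        \<open>n\<close>: it falls in the block of \<open>g\<close>, and \<open>f\<close>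
        contributes 0.\<close>
      then have "n + k - 1 - i - n = k - 1 - i" by simp
      with True f0 show ?thesis
        unfolding coeff_reversal_littlewood[OF fg \<open>i < n + k\<close>]
        unfolding lp_join_eq[OF f]
          lp_join_eq[OF reflect_poly_littlewood[OF g]]
        by (auto simp: coeff_reversal_littlewood[OF g] coeff_monom_mult)
    next
      case False
      \<comment> \<open>Now the mirrored index is below \<open>n\<close>, inside the block of
        \<open>f\<close>.\<close>
      then have "n + k - 1 - i = n - 1 - (i - k)" "i - k < n"
        using \<open>i < n + k\<close> by auto
      with False g0 show ?thesis
        unfolding coeff_reversal_littlewood[OF fg \<open>i < n + k\<close>]
        unfolding lp_join_eq[OF f]
          lp_join_eq[OF reflect_poly_littlewood[OF g]]
        by (auto simp: coeff_reversal_littlewood[OF f] coeff_monom_mult)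
    qed
  next
    case False
    then show ?thesis
      using reflect_poly_littlewood[OF fg] gf by (simp add: littlewood_iff)
  qed
qed

text \<open>Reversing twice loses trailing zeros of a general polynomial; here the constant
  coefficient is 1 or -1 unless the polynomial is 0.\<close>

lemma reflect_poly_reflect_poly_littlewood:
  assumes "f \<in> littlewood n"
  shows "reflect_poly (reflect_poly f) = f"
proof (cases "n = 0")
  case True
  with assms show ?thesis by (auto simp: littlewood_def)
next
  case False
  with assms have "coeff f 0 \<in> {1, -1}" by (simp add: littlewood_iff)
  then show ?thesis by (intro reflect_poly_reflect_poly) auto
qed

lemma lp_symm_littlewood:
  assumes "f \<in> littlewood n" and "s \<in> {1, -1}"
  shows "lp_symm s f \<in> littlewood (2 * n)"
  using join_littlewood[OF assms(1) reversal_littlewood[OF assms]]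
  by (simp add: lp_symm_def mult_2)

text \<open>Reversal swaps the two blocks of \<open>lp_symm s g\<close>, and
  \<open>s * s = 1\<close> lets a factor \<open>s\<close> be taken out of both.\<close>

lemma reflect_poly_lp_symm:
  assumes g: "g \<in> littlewood k" and s: "s \<in> {1, -1}"
  shows "reflect_poly (lp_symm s g) = smult s (lp_symm s g)"
proof -
  have "reflect_poly (lp_symm s g) = smult s g \<squnion>\<^sub>L reflect_poly g"
    unfolding lp_symm_def
    by (simp add: reflect_poly_join[OF g reversal_littlewood[OF g s]] reflect_poly_smult
        reflect_poly_reflect_poly_littlewood[OF g])
  moreover have "smult s g \<in> littlewood k"
    using reversal_littlewood[OF reflect_poly_littlewood[OF g] s]
    by (simp add: reflect_poly_reflect_poly_littlewood[OF g])
  moreover have "s * s = 1" using s by auto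
  ultimately show ?thesis
    by (simp add: lp_symm_def lp_join_eq[OF g] lp_join_eq smult_add_right)
qed

text \<open>This expansion serves twice: with the block \<open>g\<close> of length \<open>k\<close>,
  and with the block \<open>lp_symm s g\<close> of length \<open>2 * k\<close>.\<close>

lemma lp_symm_join:
  assumes f: "f \<in> littlewood n" and g: "g \<in> littlewood k"
  shows "lp_symm s (f \<squnion>\<^sub>L g) = f + monom 1 n * g +
    smult s (monom 1 (n + k) * reflect_poly g + monom 1 (n + 2 * k) * reflect_poly f)"
proof -
  have "monom 1 (n + k) * monom 1 k = (monom 1 (n + 2 * k) :: int poly)"
    by (simp add: mult_monom mult_2 add.assoc)
  moreover have "lp_symm s (f \<squnion>\<^sub>L g) =
      (f \<squnion>\<^sub>L g) + monom 1 (n + k) * smult s (reflect_poly g \<squnion>\<^sub>L reflect_poly f)"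
    by (simp add: lp_symm_def lp_join_eq[OF join_littlewood[OF f g]] reflect_poly_join[OF f g])
  ultimately show ?thesis
    by (simp add: lp_join_eq[OF f] lp_join_eq[OF reflect_poly_littlewood[OF g]]
        distrib_left smult_add_right mult.assoc [symmetric])
qed

lemma lp_symm_recurrence:
  assumes f: "f \<in> littlewood n" and g: "g \<in> littlewood k" and s: "s \<in> {1, -1}"
  shows "lp_symm s (f \<squnion>\<^sub>L lp_symm s g) =
    (1 + monom 1 (2 * k)) * lp_symm s (f \<squnion>\<^sub>L g) - monom 1 (2 * k) * lp_symm s f"
proof -
  \<comment> \<open>With the scalar \<open>s\<close> as a constant polynomial and all shifts as
    products of \<open>x\<close> and \<open>y\<close>, the claim becomes a commutative ring identity
    modulo \<open>z * z = 1\<close>.\<close>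
  define x y z :: "int poly" where "x = monom 1 n" and "y = monom 1 k" and "z = [:s:]"
  have xy: "monom 1 (n + k) = x * y" "monom 1 (n + 2 * k) = x * y * y" "monom 1 (2 * k) = y * y"
    "monom 1 (n + 2 * (2 * k)) = x * y * y * y * y"
    by (simp_all add: x_def y_def mult_monom mult_2 add.assoc)
  have sm: "smult s p = z * p" for p by (simp add: z_def)
  have zz: "z * z = 1" using s by (auto simp: z_def one_pCons)
  have h: "lp_symm s g = g + y * (z * reflect_poly g)"
    by (simp add: lp_symm_def lp_join_eq[OF g] y_def sm)
  have S: "lp_symm s f = f + x * (z * reflect_poly f)"
    by (simp add: lp_symm_def lp_join_eq[OF f] x_def sm)
  have S1: "lp_symm s (f \<squnion>\<^sub>L g) = f + x * g +
      z * (x * y * reflect_poly g + x * y * y * reflect_poly f)"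
    unfolding lp_symm_join[OF f g] xy sm x_def[symmetric] ..
  have "lp_symm s (f \<squnion>\<^sub>L lp_symm s g) = f + x * lp_symm s g +
      z * (x * y * y * (z * lp_symm s g) + x * y * y * y * y * reflect_poly f)"
    unfolding lp_symm_join[OF f lp_symm_littlewood[OF g s]] reflect_poly_lp_symm[OF g s]
      xy sm x_def[symmetric] ..
  \<comment> \<open>The regrouping exposes \<open>z * z\<close>, so that \<open>zz\<close> can
    rewrite it to 1.\<close>
  also have "\<dots> = f + x * lp_symm s g +
      ((z * z) * (x * y * y * lp_symm s g) + z * (x * y * y * y * y * reflect_poly f))"
    by (simp only: algebra_simps)
  finally show ?thesis
    unfolding zz S S1 h xy by (simp add: algebra_simps)
qed

theorem theorem6p1:
  fixes m n \<delta> :: nat and s :: int and f g f\<^sub>1 f\<^sub>2 :: "int poly"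
  assumes "m > 0"
    and "s = (-1) ^ m"
    and "f \<in> littlewood n"
    and "g \<in> littlewood \<delta>"
    and "f\<^sub>1 = f \<squnion>\<^sub>L g"
    and "f\<^sub>2 = f \<squnion>\<^sub>L g \<squnion>\<^sub>L smult s (reflect_poly g)"
    and "lp_symm s f \<in> littlewood_order (2 * n) m"
    and "lp_symm s f\<^sub>1 \<in> littlewood_order (2 * n + 2 * \<delta>) m"
  shows "lp_symm s f\<^sub>2 \<in> littlewood_order (2 * n + 4 * \<delta>) m"
proof -
  have s: "s \<in> {1, -1}"
    using assms(2) by (cases "even m") auto
  \<comment> \<open>The join is declared \<open>infixr\<close>, so the last two blocks already form
    \<open>lp_symm s g\<close>.\<close>
  have f2: "f\<^sub>2 = f \<squnion>\<^sub>L lp_symm s g"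
    using assms(6) by (simp add: lp_symm_def)
  have "lp_symm s f\<^sub>2 \<in> littlewood (2 * (n + 2 * \<delta>))"
    unfolding f2 using assms(3,4) s by (intro lp_symm_littlewood join_littlewood)
  moreover have "[:-1, 1:] ^ m dvd lp_symm s f\<^sub>2"
    unfolding f2 lp_symm_recurrence[OF assms(3,4) s]
    using assms(5,7,8) by (intro dvd_diff dvd_mult) (simp_all add: littlewood_order_def)
  ultimately show ?thesis
    by (simp add: littlewood_order_def algebra_simps)
qed

end
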